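(* There is no algorithm in the read/write streams model that uses only one stream, $\log^{O(1)} n$ bits of internal memory and $\log^{O(1)} n$ passes and that, given as input a small context-free grammar generating exactly one string $s$ of length $n$ (in particular, grammars of size $\log^{O(1)} n$ bits), writes out $s$.
   Context: Read/write streams model: an algorithm has an internal memory of $m$ bits and access to a fixed number of streams (tapes); each stream is a sequence of cells accessed sequentially by a read/write head; a pass is one sequential sweep over a stream. The input is initially on the stream. Grammar sizes are measured in bits. *)

theory Defs
  imports Complex_Main "HOL-Library.Landau_Symbols"
begin

section \<open>Context-free grammars\<close>

datatype symb = Nt nat | Tm nat

record cfg =
  start :: nat
  prods :: "(nat \<times> symb list) list"

definition over_alphabet :: "nat \<Rightarrow> cfg \<Rightarrow> bool" where
  "over_alphabet \<sigma> G \<longleftrightarrow> (\<forall>(A, w) \<in> set (prods G). \<forall>a. Tm a \<in> set w \<longrightarrow> a < \<sigma>)"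

inductive derive1 :: "cfg \<Rightarrow> symb list \<Rightarrow> symb list \<Rightarrow> bool" for G where
  "(A, w) \<in> set (prods G) \<Longrightarrow> derive1 G (u @ Nt A # v) (u @ w @ v)"

definition language :: "cfg \<Rightarrow> nat list set" where
  "language G = {w. (derive1 G)\<^sup>*\<^sup>* [Nt (start G)] (map Tm w)}"


section \<open>Binary encoding of grammars\<close>

text \<open>
  Every item of a list is preceded by the bit \<open>True\<close>, and \<open>False\<close> ends the list. Numbers
  are written in binary, so a grammar with \<open>l\<close> symbol occurrences and productions, all of
  whose names are below \<open>k\<close>, takes \<open>O(l log k)\<close> bits. The encoding is
  injective (\<open>encode_inject\<close> below).
\<close>

definition enc_list :: "('a \<Rightarrow> bool list) \<Rightarrow> 'a list \<Rightarrow> bool list" where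
  "enc_list f xs = concat (map (\<lambda>x. True # f x) xs) @ [False]"

fun binary :: "nat \<Rightarrow> bool list" where
  "binary n = (if n = 0 then [] else odd n # binary (n div 2))"

declare binary.simps [simp del]

definition enc_nat :: "nat \<Rightarrow> bool list" where
  "enc_nat n = enc_list (\<lambda>b. [b]) (binary n)"

fun enc_symb :: "symb \<Rightarrow> bool list" where
  "enc_symb (Nt A) = False # enc_nat A"
| "enc_symb (Tm a) = True # enc_nat a"

fun enc_prod :: "nat \<times> symb list \<Rightarrow> bool list" where
  "enc_prod (A, w) = enc_nat A @ enc_list enc_symb w"

definition encode :: "cfg \<Rightarrow> bool list" where
  "encode G = enc_nat (start G) @ enc_list enc_prod (prods G)"

definition prefix_code :: "('a \<Rightarrow> bool list) \<Rightarrow> bool" where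
  "prefix_code f \<longleftrightarrow> (\<forall>x y u v. f x @ u = f y @ v \<longrightarrow> x = y \<and> u = v)"

lemma prefix_codeI:
  "(\<And>x y u v. f x @ u = f y @ v \<Longrightarrow> x = y \<and> u = v) \<Longrightarrow> prefix_code f"
  unfolding prefix_code_def by (intro allI impI)

lemma prefix_codeD:
  assumes "prefix_code f" "f x @ u = f y @ v"
  shows "x = y" "u = v"
  using assms(1)[unfolded prefix_code_def, rule_format, OF assms(2)] by simp_all

lemma enc_list_simps:
  "enc_list f [] = [False]"
  "enc_list f (x # xs) = True # f x @ enc_list f xs"
  by (simp_all add: enc_list_def)

lemma prefix_code_enc_list:
  assumes "prefix_code f"
  shows "prefix_code (enc_list f)"
proof (rule prefix_codeI)
  fix xs ys u v
  assume "enc_list f xs @ u = enc_list f ys @ v"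
  then show "xs = ys \<and> u = v"
  proof (induction xs arbitrary: ys)
    case Nil
    then show ?case by (cases ys) (simp_all add: enc_list_simps)
  next
    case (Cons x xs)
    then obtain y ys' where ys: "ys = y # ys'"
      by (cases ys) (simp_all add: enc_list_simps)
    have eq: "f x @ (enc_list f xs @ u) = f y @ (enc_list f ys' @ v)"
      using Cons.prems by (simp add: ys enc_list_simps)
    from Cons.IH[OF prefix_codeD(2)[OF assms eq]] prefix_codeD(1)[OF assms eq] ys
    show ?case by simp
  qed
qed

lemma horner_sum_binary: "horner_sum of_bool 2 (binary n) = n"
proof (induction n rule: binary.induct)
  case (1 n)
  show ?case
  proof (cases "n = 0")
    case True
    then show ?thesis by (simp add: binary.simps[of 0])
  next
    case False
    have "horner_sum of_bool 2 (binary n) = of_bool (odd n) + 2 * (n div 2)"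
      using 1[OF False] False by (simp add: binary.simps[of n])
    also have "\<dots> = n" by (cases "odd n") simp_all
    finally show ?thesis .
  qed
qed

lemma binary_inject: "binary m = binary n \<Longrightarrow> m = n"
  by (metis horner_sum_binary)

lemma prefix_code_enc_nat: "prefix_code enc_nat"
proof (rule prefix_codeI)
  have *: "prefix_code (enc_list (\<lambda>b. [b]))"
    by (rule prefix_code_enc_list) (simp add: prefix_code_def)
  fix m n u v
  assume "enc_nat m @ u = enc_nat n @ v"
  note 1 = prefix_codeD[OF * this[unfolded enc_nat_def]]
  show "m = n \<and> u = v" by (intro conjI binary_inject 1)
qed

lemma prefix_code_enc_symb: "prefix_code enc_symb"
proof (rule prefix_codeI)
  fix x y u v
  assume eq: "enc_symb x @ u = enc_symb y @ v"
  note nat = prefix_codeD[OF prefix_code_enc_nat]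
  show "x = y \<and> u = v"
  proof (cases x)
    case x: (Nt A)
    with eq obtain B where y: "y = Nt B" by (cases y) simp_all
    with x eq have "enc_nat A @ u = enc_nat B @ v" by simp
    from nat[OF this] x y show ?thesis by simp
  next
    case x: (Tm a)
    with eq obtain b where y: "y = Tm b" by (cases y) simp_all
    with x eq have "enc_nat a @ u = enc_nat b @ v" by simp
    from nat[OF this] x y show ?thesis by simp
  qed
qed

lemma prefix_code_enc_prod: "prefix_code enc_prod"
proof (rule prefix_codeI)
  fix x y u v
  assume eq: "enc_prod x @ u = enc_prod y @ v"
  obtain A w where x: "x = (A, w)" by (rule prod.exhaust)
  obtain B z where y: "y = (B, z)" by (rule prod.exhaust)
  have "enc_nat A @ (enc_list enc_symb w @ u) = enc_nat B @ (enc_list enc_symb z @ v)"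
    using eq by (simp add: x y)
  note 1 = prefix_codeD[OF prefix_code_enc_nat this]
  note 2 = prefix_codeD[OF prefix_code_enc_list[OF prefix_code_enc_symb] 1(2)]
  show "x = y \<and> u = v" using 1(1) 2 x y by simp
qed

lemma encode_inject:
  assumes "encode G = encode H"
  shows "G = H"
proof -
  have eq: "enc_nat (start G) @ (enc_list enc_prod (prods G) @ []) =
        enc_nat (start H) @ (enc_list enc_prod (prods H) @ [])"
    using assms by (simp add: encode_def)
  note 1 = prefix_codeD[OF prefix_code_enc_nat eq]
  from prefix_codeD(1)[OF prefix_code_enc_list[OF prefix_code_enc_prod] 1(2)] 1(1)
  show ?thesis by simp
qed


section \<open>Algorithms with one read/write stream\<close>

text \<open>
  The internal memory is a list of bits. In each step an algorithm sees its memory and the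
  cell under the head; it updates both and then moves the head to a neighbouring cell or
  halts. All internal computation between two accesses to the stream is contained in one
  step and is not charged for.
\<close>

datatype cell = Blank | Sym nat

datatype dir = Leftward | Rightward

datatype action = Move dir | Halt

type_synonym algorithm = "bool list \<Rightarrow> cell \<Rightarrow> bool list \<times> cell \<times> action"

definition cells :: "nat \<Rightarrow> cell set" where
  "cells q = insert Blank (Sym ` {..<q})"

definition one_stream_algorithm :: "nat \<Rightarrow> algorithm \<Rightarrow> bool" where
  "one_stream_algorithm q A \<longleftrightarrow>
     (\<forall>mem. \<forall>x \<in> cells q. case A mem x of (mem', x', _) \<Rightarrow>
        length mem' = length mem \<and> x' \<in> cells q)"

text \<open>
  A pass is a maximal part of the run in which the head does not reverse its direction;
  \<open>passes\<close> counts the passes begun so far.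
\<close>

record config =
  memory :: "bool list"
  stream :: "nat \<Rightarrow> cell"
  head :: nat
  heading :: dir
  passes :: nat
  halted :: bool

fun neighbour :: "dir \<Rightarrow> nat \<Rightarrow> nat" where
  "neighbour Leftward i = i - 1"
| "neighbour Rightward i = i + 1"

definition step :: "algorithm \<Rightarrow> config \<Rightarrow> config" where
  "step A c =
    (if halted c then c
     else case A (memory c) (stream c (head c)) of (mem', x', act) \<Rightarrow>
       let str = (stream c)(head c := x') in
       case act of
         Halt \<Rightarrow> c\<lparr>memory := mem', stream := str, halted := True\<rparr>
       | Move d \<Rightarrow>
           \<lparr>memory = mem', stream = str, head = neighbour d (head c), heading = d,
            passes = passes c + (if d = heading c then 0 else 1), halted = False\<rparr>)"

definition bit_cell :: "bool \<Rightarrow> cell" where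
  "bit_cell b = Sym (if b then 1 else 0)"

definition initial :: "nat \<Rightarrow> bool list \<Rightarrow> config" where
  "initial m x =
    \<lparr>memory = replicate m False,
     stream = (\<lambda>i. if i < length x then bit_cell (x ! i) else Blank),
     head = 0, heading = Rightward, passes = 1, halted = False\<rparr>"

text \<open>The string need not start at the first cell of the stream.\<close>

definition holds_string :: "(nat \<Rightarrow> cell) \<Rightarrow> nat list \<Rightarrow> bool" where
  "holds_string str s \<longleftrightarrow>
     (\<exists>i. \<forall>j. str j = (if i \<le> j \<and> j < i + length s then Sym (s ! (j - i)) else Blank))"

definition writes_out :: "algorithm \<Rightarrow> nat \<Rightarrow> nat \<Rightarrow> bool list \<Rightarrow> nat list \<Rightarrow> bool" where
  "writes_out A m p x s \<longleftrightarrow>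
     (\<exists>t. let c = (step A ^^ t) (initial m x) in
        halted c \<and> passes c \<le> p \<and> holds_string (stream c) s)"


section \<open>Polylogarithmic bounds\<close>

definition polylog :: "(nat \<Rightarrow> nat) \<Rightarrow> bool" where
  "polylog f \<longleftrightarrow> (\<exists>k::nat. (\<lambda>n. real (f n)) \<in> O(\<lambda>n. log 2 (real n) ^ k))"

end

theory Submission
  imports Defs "HOL-Library.While_Combinator" "HOL-Real_Asymp.Real_Asymp"
begin

text \<open>
  During one pass the head enters a given block of \<open>l\<close> cells at most once. Hence, if the block is
  initially blank, its final content is determined by at most \<open>p\<close> pairs (memory on entry, end at
  which the head enters), so at most \<open>2 ^ ((m + 1) * (p + 1))\<close> contents are possible, wherever
  the block lies. With \<open>l = (m + 1) * (p + 1) + 1\<close>, some binary string \<open>u\<close> of length \<open>l\<close> cannot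
  appear there. However, \<open>0\<^sup>N u\<close> with \<open>N = n - l\<close> has a grammar of polylogarithmic size
  (repeated doubling for \<open>0\<^sup>N\<close>), and for large \<open>n\<close> its last \<open>l\<close> letters lie beyond the
  cells occupied by the input, wherever the output starts.
\<close>

section \<open>Visits to a window of the stream\<close>

text \<open>
  The window consists of the cells \<open>b + 1, \<dots>, b + l\<close>, numbered \<open>1, \<dots>, l\<close> locally, so that
  leaving on the left is the local position \<open>0\<close>. Halting also ends a visit and is encoded
  by a jump to position \<open>0\<close>.
\<close>

fun window_step ::
  "algorithm \<Rightarrow> bool list \<times> nat \<times> (nat \<Rightarrow> cell) \<Rightarrow> bool list \<times> nat \<times> (nat \<Rightarrow> cell)" where
  "window_step A (mem, r, f) =
    (case A mem (f r) of (mem', x, act) \<Rightarrow>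
      (mem', (case act of Halt \<Rightarrow> 0 | Move d \<Rightarrow> neighbour d r), f(r := x)))"

text \<open>For a visit that never ends, \<open>while\<close> returns an unspecified value. This is
  harmless, since \<open>while_unfold\<close> holds without termination.\<close>

definition visit ::
  "algorithm \<Rightarrow> nat \<Rightarrow> (nat \<Rightarrow> cell) \<Rightarrow> bool list \<times> nat \<Rightarrow> (nat \<Rightarrow> cell)" where
  "visit A l f e =
    snd (snd (while (\<lambda>(mem, r, f). r \<in> {1..l}) (window_step A) (fst e, snd e, f)))"

lemma visit_outside: "r \<notin> {1..l} \<Longrightarrow> visit A l f (mem, r) = f"
  unfolding visit_def by (subst while_unfold) auto

lemma visit_inside:
  assumes "r \<in> {1..l}" "A mem (f r) = (mem', x, act)"
  shows "visit A l f (mem, r) =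
    visit A l (f(r := x)) (mem', case act of Halt \<Rightarrow> 0 | Move d \<Rightarrow> neighbour d r)"
  unfolding visit_def using assms by (subst while_unfold) simp

text \<open>Local coordinates and the default \<open>Blank\<close> outside make windows at different
  \<open>b\<close> comparable.\<close>

definition window :: "nat \<Rightarrow> nat \<Rightarrow> config \<Rightarrow> nat \<Rightarrow> cell" where
  "window b l c = (\<lambda>r. if r \<in> {1..l} then stream c (b + r) else Blank)"

definition window_pos :: "nat \<Rightarrow> nat \<Rightarrow> config \<Rightarrow> nat" where
  "window_pos b l c = (if \<not> halted c \<and> head c \<in> {b+1..b+l} then head c - b else 0)"

text \<open>An entry does not record \<open>b\<close>, so one count serves all positions of the
  window.\<close>

definition entries :: "nat \<Rightarrow> nat \<Rightarrow> (bool list \<times> nat) set" where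
  "entries k l = {mem. length mem = k} \<times> {1, l}"

definition approaching :: "nat \<Rightarrow> nat \<Rightarrow> config \<Rightarrow> bool" where
  "approaching b l c \<longleftrightarrow>
    (case heading c of Rightward \<Rightarrow> head c \<le> b | Leftward \<Rightarrow> b + l < head c)"

text \<open>
  When the head is approaching the window, the current pass has not entered it yet, which leaves
  room for one more entry. For a head inside the window, the equation below says that the
  entries so far lead to the content that the current visit is going to leave behind if it ends;
  this makes it invariant also under the steps inside the window.
\<close>

definition window_explained :: "algorithm \<Rightarrow> nat \<Rightarrow> nat \<Rightarrow> nat \<Rightarrow> config \<Rightarrow> bool" where
  "window_explained A k b l c \<longleftrightarrow>
    (\<exists>es. set es \<subseteq> entries k l \<and>
      length es + of_bool (approaching b l c) \<le> passes c \<and>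
      foldl (visit A l) (\<lambda>_. Blank) es = visit A l (window b l c) (memory c, window_pos b l c))"

definition well_formed :: "nat \<Rightarrow> nat \<Rightarrow> config \<Rightarrow> bool" where
  "well_formed q k c \<longleftrightarrow> length (memory c) = k \<and> (\<forall>i. stream c i \<in> cells q)"

lemma one_stream_algorithmD:
  assumes "one_stream_algorithm q A" "y \<in> cells q" "A mem y = (mem', x, act)"
  shows "length mem' = length mem" "x \<in> cells q"
  using assms(1)[unfolded one_stream_algorithm_def, rule_format, OF assms(2), of mem] assms(3)
  by simp_all

lemma well_formed_step:
  assumes "one_stream_algorithm q A" "well_formed q k c"
  shows "well_formed q k (step A c)"
proof -
  obtain mem x act where eq: "A (memory c) (stream c (head c)) = (mem, x, act)"
    by (metis prod_cases3)
  have "length mem = length (memory c) \<and> x \<in> cells q"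
    using one_stream_algorithmD[OF assms(1) _ eq] assms(2) by (simp add: well_formed_def)
  then show ?thesis
    using assms eq by (cases act) (auto simp: well_formed_def step_def)
qed

text \<open>An approaching head holds a credit: one pass not yet spent on an entry. Entering spends
  it, and only a reversal, which begins a new pass, can supply another.\<close>

lemma window_explained_step:
  assumes A: "one_stream_algorithm q A" and wf: "well_formed q k c" and l: "1 \<le> l"
    and ex: "window_explained A k b l c"
  shows "window_explained A k b l (step A c)"
proof (cases "halted c")
  case True
  then show ?thesis using ex by (simp add: step_def)
next
  case running: False
  define c' where "c' = step A c"
  obtain mem x act where eq: "A (memory c) (stream c (head c)) = (mem, x, act)"
    by (metis prod_cases3)
  have mem: "length mem = k"
    using one_stream_algorithmD(1)[OF A _ eq] wf by (simp add: well_formed_def)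
  have c': "memory c' = mem" "stream c' = (stream c)(head c := x)"
    using running eq by (auto simp: c'_def step_def Let_def split: action.splits)
  have halt: "halted c'" "head c' = head c" "heading c' = heading c" "passes c' = passes c"
    if "act = Halt"
    using running eq that by (auto simp: c'_def step_def)
  have move: "\<not> halted c'" "head c' = neighbour d (head c)" "heading c' = d"
    "passes c' = passes c + (if d = heading c then 0 else 1)" if "act = Move d" for d
    using running eq that by (auto simp: c'_def step_def)
  obtain es where es: "set es \<subseteq> entries k l"
    "length es + of_bool (approaching b l c) \<le> passes c"
    "foldl (visit A l) (\<lambda>_. Blank) es = visit A l (window b l c) (memory c, window_pos b l c)"
    using ex unfolding window_explained_def by blast
  show ?thesis
  proof (cases "head c \<in> {b+1..b+l}")
    case True
    define r where "r = head c - b"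
    have r: "r \<in> {1..l}" "head c = b + r" using True by (auto simp: r_def)
    have pos: "window_pos b l c = r" using running True by (simp add: window_pos_def r_def)
    have win: "(window b l c)(r := x) = window b l c'"
      using r by (auto simp: window_def c' fun_eq_iff)
    \<comment> \<open>A step inside the window is one unrolling of the loop, so the same
      \<open>es\<close> still predicts the final content.\<close>
    have "visit A l (window b l c) (memory c, r) =
        visit A l (window b l c') (mem, case act of Halt \<Rightarrow> 0 | Move d \<Rightarrow> neighbour d r)"
      using visit_inside[of r l A "memory c" "window b l c" mem x act] r eq win
      by (simp add: window_def)
    also have "\<dots> = visit A l (window b l c') (mem, window_pos b l c')"
    proof (cases act)
      case (Move d)
      show ?thesis
      proof (cases "neighbour d r \<in> {1..l}")
        case True
        then have "window_pos b l c' = neighbour d r"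
          using move[OF Move] r by (cases d) (auto simp: window_pos_def)
        then show ?thesis using Move by simp
      next
        \<comment> \<open>Leaving on the right gives local position \<open>l + 1\<close> rather than
          \<open>0\<close>; both lie outside \<open>{1..l}\<close>, so either visit ends at
          once.\<close>
        case False
        then have "window_pos b l c' = 0"
          using move[OF Move] r by (cases d) (auto simp: window_pos_def)
        then show ?thesis using Move False by (simp add: visit_outside)
      qed
    qed (use halt in \<open>simp add: window_pos_def\<close>)
    finally have "foldl (visit A l) (\<lambda>_. Blank) es =
        visit A l (window b l c') (memory c', window_pos b l c')"
      using es(3) pos c' by simp
    moreover have "length es + of_bool (approaching b l c') \<le> passes c'"
    proof (cases act)
      case (Move d)
      show ?thesis
        using es(2) move[OF Move] r
        by (cases d; cases "heading c") (auto simp: approaching_def)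
    next
      case Halt
      then have "approaching b l c' = approaching b l c"
        using halt by (simp add: approaching_def split: dir.split)
      then show ?thesis using es(2) halt(4) Halt by simp
    qed
    ultimately show ?thesis
      using es(1) unfolding window_explained_def c'_def by blast
  next
    case False
    have win: "window b l c' = window b l c"
      using False by (auto simp: window_def c' fun_eq_iff)
    have pos: "window_pos b l c = 0" using False by (simp add: window_pos_def)
    have fold: "foldl (visit A l) (\<lambda>_. Blank) es = window b l c'"
      using es(3) by (simp add: pos win visit_outside)
    show ?thesis
    proof (cases "\<not> halted c' \<and> head c' \<in> {b+1..b+l}")
      case True
      then obtain d where d: "act = Move d" using halt(1) by (cases act) auto
      have r: "window_pos b l c' \<in> {1, l}"
        using True False move[OF d] l by (cases d) (auto simp: window_pos_def)
      \<comment> \<open>With unchanged heading the head was approaching and its credit pays for the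
        new entry; otherwise the reversal adds a pass that pays.\<close>
      have "length (es @ [(mem, window_pos b l c')]) + of_bool (approaching b l c') \<le> passes c'"
        using es(2) move[OF d] True False
        by (cases d; cases "heading c") (auto simp: approaching_def)
      moreover have "set (es @ [(mem, window_pos b l c')]) \<subseteq> entries k l"
        using es(1) mem r by (auto simp: entries_def)
      moreover have "foldl (visit A l) (\<lambda>_. Blank) (es @ [(mem, window_pos b l c')]) =
          visit A l (window b l c') (memory c', window_pos b l c')"
        by (simp add: fold c')
      ultimately show ?thesis
        unfolding window_explained_def c'_def by blast
    next
      case outside: False
      then have "window_pos b l c' = 0" by (auto simp: window_pos_def)
      then have "foldl (visit A l) (\<lambda>_. Blank) es =
          visit A l (window b l c') (memory c', window_pos b l c')"
        by (simp add: fold visit_outside)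
      \<comment> \<open>Without a reversal, a head approaching after the move was already
        approaching before it.\<close>
      moreover have "length es + of_bool (approaching b l c') \<le> passes c'"
      proof (cases act)
        case (Move d)
        show ?thesis
          using es(2) move[OF Move] outside False
          by (cases d; cases "heading c") (auto simp: approaching_def split: if_splits)
      next
        case Halt
        then have "approaching b l c' = approaching b l c"
          using halt by (simp add: approaching_def split: dir.split)
        then show ?thesis using es(2) halt(4) Halt by simp
      qed
      ultimately show ?thesis
        using es(1) unfolding window_explained_def c'_def by blast
    qed
  qed
qed

text \<open>The bound on \<open>length x\<close> confines the input to the cells \<open>0\<close> to
  \<open>b\<close>, so the window starts blank; \<open>2 \<le> q\<close> makes the input bits legal
  symbols.\<close>

lemma window_explained_run:
  assumes "one_stream_algorithm q A" "2 \<le> q" "1 \<le> l" "length x \<le> b + 1"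
  shows "window_explained A k b l ((step A ^^ t) (initial k x))"
proof -
  have "well_formed q k ((step A ^^ t) (initial k x)) \<and>
    window_explained A k b l ((step A ^^ t) (initial k x))"
  proof (induction t)
    case 0
    have "well_formed q k (initial k x)"
      using assms(2) by (auto simp: well_formed_def initial_def cells_def bit_cell_def)
    \<comment> \<open>The head starts at \<open>0 \<le> b\<close> heading right, hence approaching;
      the initial pass count \<open>1\<close> covers this credit.\<close>
    moreover have "window_explained A k b l (initial k x)"
      unfolding window_explained_def using assms(4)
      by (intro exI[of _ "[]"])
        (auto simp: initial_def approaching_def window_pos_def visit_outside window_def)
    ultimately show ?case by simp
  next
    case (Suc t)
    then show ?case
      using well_formed_step[OF assms(1)] window_explained_step[OF assms(1) _ assms(3)] by simp
  qed
  then show ?thesis ..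
qed

section \<open>Counting the possible window contents\<close>

text \<open>There are at most \<open>2 ^ (k + 1)\<close> entries, and a geometric sum with ratio at
  least \<open>2\<close> is bounded by the next power.\<close>

lemma card_entry_lists:
  "finite {es. set es \<subseteq> entries k l \<and> length es \<le> p}"
  "card {es. set es \<subseteq> entries k l \<and> length es \<le> p} \<le> 2 ^ ((k + 1) * (p + 1))"
proof -
  have mems: "{mem :: bool list. length mem = k} = {mem. set mem \<subseteq> UNIV \<and> length mem = k}"
    by simp
  have fin: "finite (entries k l)"
    unfolding entries_def mems by (intro finite_cartesian_product finite_lists_length_eq) auto
  have "card {mem :: bool list. length mem = k} = 2 ^ k"
    unfolding mems by (subst card_lists_length_eq) auto
  then have card: "card (entries k l) \<le> 2 ^ (k + 1)"
    by (simp add: entries_def card_cartesian_product card_insert_if)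
  show "finite {es. set es \<subseteq> entries k l \<and> length es \<le> p}"
    by (rule finite_lists_length_le[OF fin])
  have sum_powers: "(\<Sum>i\<le>j. N ^ i) \<le> N ^ (j + 1)" if "2 \<le> N" for N j :: nat
  proof (induction j)
    case (Suc j)
    have "(\<Sum>i\<le>Suc j. N ^ i) \<le> 2 * N ^ (j + 1)" using Suc by simp
    also have "\<dots> \<le> N * N ^ (j + 1)" using that by (rule mult_right_mono) simp
    finally show ?case by simp
  qed (use that in simp)
  have "card {es. set es \<subseteq> entries k l \<and> length es \<le> p} = (\<Sum>i\<le>p. card (entries k l) ^ i)"
    by (rule card_lists_length_le[OF fin])
  also have "\<dots> \<le> (\<Sum>i\<le>p. (2 ^ (k + 1)) ^ i)"
    by (intro sum_mono power_mono card) simp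
  also have "\<dots> \<le> (2 ^ (k + 1)) ^ (p + 1)"
    by (rule sum_powers) simp
  finally show "card {es. set es \<subseteq> entries k l \<and> length es \<le> p} \<le> 2 ^ ((k + 1) * (p + 1))"
    by (simp only: power_mult)
qed

text \<open>The entry list alone determines \<open>u\<close>, although \<open>x\<close> and
  \<open>v\<close> may vary with \<open>u\<close>. Hence the \<open>2 ^ l\<close> strings require as
  many entry lists.\<close>

lemma writes_out_all_suffixes:
  assumes A: "one_stream_algorithm q A" "2 \<le> q" and l: "1 \<le> l"
    and writes: "\<And>u. set u \<subseteq> {0, 1} \<Longrightarrow> length u = l \<Longrightarrow>
      \<exists>x v. length x \<le> length v \<and> v \<noteq> [] \<and> writes_out A k p x (v @ u)"
  shows "l \<le> (k + 1) * (p + 1)"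
proof -
  let ?E = "{es. set es \<subseteq> entries k l \<and> length es \<le> p}"
  let ?U = "{u. set u \<subseteq> {0, 1 :: nat} \<and> length u = l}"
  \<comment> \<open>\<open>Suc r\<close> appears because local cells are numbered from
    \<open>1\<close>; the value \<open>0\<close> for \<open>Blank\<close> is an arbitrary
    default.\<close>
  define out where "out es = map (\<lambda>r. case foldl (visit A l) (\<lambda>_. Blank) es (Suc r) of
    Sym a \<Rightarrow> a | Blank \<Rightarrow> 0) [0..<l]" for es
  have "u \<in> out ` ?E" if "u \<in> ?U" for u
  proof -
    from writes[of u] that obtain x v where v: "length x \<le> length v" "v \<noteq> []"
      and "writes_out A k p x (v @ u)"
      by auto
    then obtain t where t: "halted ((step A ^^ t) (initial k x))"
      "passes ((step A ^^ t) (initial k x)) \<le> p"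
      "holds_string (stream ((step A ^^ t) (initial k x))) (v @ u)"
      unfolding writes_out_def Let_def by blast
    define c where "c = (step A ^^ t) (initial k x)"
    obtain i where i: "stream c j =
      (if i \<le> j \<and> j < i + length (v @ u) then Sym ((v @ u) ! (j - i)) else Blank)" for j
      using t(3) unfolding holds_string_def c_def by blast
    \<comment> \<open>Local cell \<open>1\<close> then holds the first letter of \<open>u\<close>.
      As \<open>v \<noteq> []\<close>, the subtraction is exact, and
      \<open>length x \<le> length v\<close> keeps the input out of the window for every
      \<open>i\<close>.\<close>
    define b where "b = i + length v - 1"
    have b: "b + Suc r = i + length v + r" for r using v(2) by (cases v) (auto simp: b_def)
    have "length x \<le> b + 1" using v b[of 0] by simp
    from window_explained_run[OF A l this, of k t] obtain es where
      es: "set es \<subseteq> entries k l" "length es \<le> passes c"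
      "foldl (visit A l) (\<lambda>_. Blank) es = visit A l (window b l c) (memory c, window_pos b l c)"
      unfolding window_explained_def c_def by (meson add_leD1)
    \<comment> \<open>After halting no visit is pending, so the entries yield the actual
      content.\<close>
    have "window_pos b l c = 0" using t(1) by (simp add: window_pos_def c_def)
    then have "foldl (visit A l) (\<lambda>_. Blank) es = window b l c"
      using es(3) by (simp add: visit_outside)
    moreover have "window b l c (Suc r) = Sym (u ! r)" if "r < l" for r
    proof -
      have "stream c (b + Suc r) = Sym (u ! r)"
        unfolding b[of r] i using that \<open>u \<in> ?U\<close> by (simp add: nth_append)
      then show ?thesis using that by (simp add: window_def)
    qed
    ultimately have "out es = map (\<lambda>r. u ! r) [0..<l]"
      by (simp add: out_def)
    also have "\<dots> = u" using \<open>u \<in> ?U\<close> map_nth[of u] by simp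
    finally have "out es = u" .
    moreover have "es \<in> ?E" using es t(2) by (simp add: c_def)
    ultimately show ?thesis by blast
  qed
  then have "card ?U \<le> card (out ` ?E)"
    by (intro card_mono finite_imageI card_entry_lists) auto
  also have "\<dots> \<le> card ?E" by (rule card_image_le[OF card_entry_lists(1)])
  also have "\<dots> \<le> 2 ^ ((k + 1) * (p + 1))" by (rule card_entry_lists(2))
  also have "card ?U = 2 ^ l"
    by (subst card_lists_length_eq) (auto simp: numeral_2_eq_2)
  finally have "(2::nat) ^ l \<le> 2 ^ ((k + 1) * (p + 1))" .
  then show ?thesis by (rule power_le_imp_le_exp[rotated]) simp
qed


section \<open>Small grammars for padded strings\<close>

lemma derives_context:
  assumes "(derive1 G)\<^sup>*\<^sup>* x y"
  shows "(derive1 G)\<^sup>*\<^sup>* (u @ x @ v) (u @ y @ v)"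
  using assms
proof induction
  case (step y z)
  from step(2) have "derive1 G (u @ y @ v) (u @ z @ v)"
  proof cases
    case (1 A w u' v')
    then show ?thesis using derive1.intros[OF 1(3), of "u @ u'" "v' @ v"] by simp
  qed
  with step(3) show ?case by (rule rtranclp.rtrancl_into_rtrancl)
qed simp

lemma derives_append:
  assumes "(derive1 G)\<^sup>*\<^sup>* x x'" "(derive1 G)\<^sup>*\<^sup>* y y'"
  shows "(derive1 G)\<^sup>*\<^sup>* (x @ y) (x' @ y')"
  using derives_context[OF assms(1), of "[]" y] derives_context[OF assms(2), of x' "[]"]
  by (auto intro: rtranclp_trans)

lemma derives_production:
  "(A, w) \<in> set (prods G) \<Longrightarrow> (derive1 G)\<^sup>*\<^sup>* w z \<Longrightarrow> (derive1 G)\<^sup>*\<^sup>* [Nt A] z"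
  using derive1.intros[of A w G "[]" "[]"] by (auto intro: converse_rtranclp_into_rtranclp)

primrec symb_value :: "(nat \<Rightarrow> nat list) \<Rightarrow> symb \<Rightarrow> nat list" where
  "symb_value val (Nt A) = val A"
| "symb_value val (Tm a) = [a]"

lemma concat_symb_value_Tm: "concat (map (symb_value val \<circ> Tm) w) = w"
  by (induction w) auto

text \<open>Productions are read as equations between strings: a valuation solving them is invariant
  under derivation. That some string is derivable must be shown separately.\<close>

lemma language_unique:
  assumes "\<And>A w. (A, w) \<in> set (prods G) \<Longrightarrow> concat (map (symb_value val) w) = val A"
    and "w \<in> language G"
  shows "w = val (start G)"
proof -
  have "concat (map (symb_value val) y) = concat (map (symb_value val) x)"
    if "(derive1 G)\<^sup>*\<^sup>* x y" for x y
    using that by induction (auto elim!: derive1.cases simp: assms(1))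
  from this[of "[Nt (start G)]" "map Tm w"] assms(2) show ?thesis
    by (simp add: language_def concat_symb_value_Tm)
qed

text \<open>Nonterminal \<open>j\<close> stands for \<open>N div 2 ^ j\<close> zeros; the optional
  terminal accounts for bit \<open>j\<close> of \<open>N\<close>.\<close>

definition padding_prod :: "nat \<Rightarrow> nat \<Rightarrow> nat \<times> symb list" where
  "padding_prod N j =
    (j, [Nt (Suc j), Nt (Suc j)] @ (if odd (N div 2 ^ j) then [Tm 0] else []))"

text \<open>The names \<open>0\<close> to \<open>K\<close> serve the padding, so the start symbol is
  \<open>Suc K\<close>. The empty production for \<open>K\<close> fits
  \<open>N < 2 ^ K\<close>.\<close>

definition padded :: "nat \<Rightarrow> nat \<Rightarrow> nat list \<Rightarrow> cfg" where
  "padded K N u =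
    \<lparr>start = Suc K,
     prods = (Suc K, Nt 0 # map Tm u) # (K, []) # map (padding_prod N) [0..<K]\<rparr>"

lemma replicate_halve:
  "replicate (N div 2 ^ j) x = replicate (N div 2 ^ Suc j) x @ replicate (N div 2 ^ Suc j) x @
    (if odd (N div 2 ^ j) then [x] else [])"
proof -
  have "N div 2 ^ j =
      N div 2 ^ Suc j + (N div 2 ^ Suc j + (if odd (N div 2 ^ j) then 1 else (0::nat)))"
    unfolding power_Suc2 div_mult2_eq by (auto elim!: oddE)
  from arg_cong[OF this, of "\<lambda>k. replicate k x"] show ?thesis
    by (simp add: replicate_add del: power_Suc)
qed

text \<open>The induction descends from \<open>K\<close>, because \<open>j\<close> is rewritten to
  two copies of \<open>Suc j\<close>.\<close>

lemma padded_padding: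
  assumes "N < 2 ^ K" "j \<le> K"
  shows "(derive1 (padded K N u))\<^sup>*\<^sup>* [Nt j] (map Tm (replicate (N div 2 ^ j) 0))"
  using assms(2)
proof (induction rule: inc_induct)
  case base
  have "(derive1 (padded K N u))\<^sup>*\<^sup>* [Nt K] []"
    by (rule derives_production[of _ "[]"]) (auto simp: padded_def)
  then show ?case using assms(1) by simp
next
  case (step j)
  let ?w = "map Tm (replicate (N div 2 ^ Suc j) 0)"
  let ?e = "if odd (N div 2 ^ j) then [Tm 0] else []"
  have "(derive1 (padded K N u))\<^sup>*\<^sup>* ([Nt (Suc j)] @ [Nt (Suc j)] @ ?e) (?w @ ?w @ ?e)"
    by (intro derives_append step.IH rtranclp.rtrancl_refl)
  then have "(derive1 (padded K N u))\<^sup>*\<^sup>* [Nt j] (?w @ ?w @ ?e)"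
    using step.hyps
    by (intro derives_production[of j "[Nt (Suc j)] @ [Nt (Suc j)] @ ?e"])
      (auto simp: padded_def padding_prod_def)
  also have "?w @ ?w @ ?e = map Tm (replicate (N div 2 ^ j) 0)"
    by (subst replicate_halve[of N j]) (simp del: power_Suc)
  finally show ?case .
qed

lemma language_padded:
  assumes "N < 2 ^ K"
  shows "language (padded K N u) = {replicate N 0 @ u}"
proof -
  let ?G = "padded K N u"
  define val where "val A = (if A = Suc K then replicate N 0 @ u else replicate (N div 2 ^ A) 0)" for A
  have "concat (map (symb_value val) w) = val A" if "(A, w) \<in> set (prods ?G)" for A w
  proof -
    have pad: "val j = val (Suc j) @ val (Suc j) @ (if odd (N div 2 ^ j) then [0] else [])"
      if "j < K" for j
      using that replicate_halve[of N j 0] by (simp add: val_def del: power_Suc)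
    from that show ?thesis
      using assms pad
      by (auto simp: padded_def padding_prod_def concat_symb_value_Tm) (auto simp: val_def)
  qed
  then have "w = replicate N 0 @ u" if "w \<in> language ?G" for w
    using language_unique[of ?G val w] that by (simp add: val_def padded_def)
  moreover have "replicate N 0 @ u \<in> language ?G"
  proof -
    have "(derive1 ?G)\<^sup>*\<^sup>* ([Nt 0] @ map Tm u) (map Tm (replicate N 0) @ map Tm u)"
      using padded_padding[OF assms, of 0 u] by (intro derives_append) auto
    then have "(derive1 ?G)\<^sup>*\<^sup>* [Nt (Suc K)] (map Tm (replicate N 0 @ u))"
      by (intro derives_production[of _ "[Nt 0] @ map Tm u"]) (auto simp: padded_def)
    then show ?thesis by (simp add: language_def padded_def)
  qed
  ultimately show ?thesis by blast
qed

section \<open>Encoded size of the padding grammars\<close>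

lemma length_enc_list_le:
  assumes "\<And>x. x \<in> set xs \<Longrightarrow> length (f x) \<le> B"
  shows "length (enc_list f xs) \<le> length xs * (B + 1) + 1"
  using assms
proof (induction xs)
  case (Cons x xs)
  then have "length (enc_list f xs) \<le> length xs * (B + 1) + 1" "length (f x) \<le> B"
    by simp_all
  then show ?case by (simp add: enc_list_simps)
qed (simp add: enc_list_simps)

text \<open>This linear bound is crude but sufficient: the names in the padding grammars are at most
  \<open>K + 1\<close>, with \<open>K\<close> logarithmic in \<open>n\<close>.\<close>

lemma length_enc_nat_le: "length (enc_nat n) \<le> 2 * n + 1"
proof -
  have "length (binary n) \<le> n" for n
  proof (induction n rule: binary.induct)
    case (1 n)
    show ?case
    proof (cases "n = 0")
      case False
      then show ?thesis using 1 by (subst binary.simps) fastforce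
    qed (simp add: binary.simps[of 0])
  qed
  then have "length (binary n) * 2 \<le> n * 2" by simp
  moreover have "length (enc_nat n) \<le> length (binary n) * (1 + 1) + 1"
    unfolding enc_nat_def by (rule length_enc_list_le) simp
  ultimately show ?thesis by simp
qed

lemma length_enc_symb_le:
  "length (enc_symb (Nt A)) \<le> 2 * A + 2" "length (enc_symb (Tm a)) \<le> 2 * a + 2"
  using length_enc_nat_le[of A] length_enc_nat_le[of a] by simp_all

text \<open>Each of the \<open>K + 2\<close> productions has an encoding linear in \<open>K\<close>
  and \<open>length u\<close>, so the total is polylogarithmic once both are.\<close>

lemma length_encode_padded:
  assumes "set u \<subseteq> {0, 1}"
  shows "length (encode (padded K N u)) \<le> (K + 2) * (8 * K + 5 * length u + 30) + 2 * K + 4"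
proof -
  have symbs: "length (enc_list enc_symb w) \<le> length w * (B + 1) + 1"
    if "\<And>x. x \<in> set w \<Longrightarrow> length (enc_symb x) \<le> B" for w B
    using that by (rule length_enc_list_le)
  have start: "length (enc_prod (Suc K, Nt 0 # map Tm u)) \<le> 2 * K + 5 * length u + 10"
  proof -
    have "length (enc_list enc_symb (Nt 0 # map Tm u)) \<le> length (Nt 0 # map Tm u) * (4 + 1) + 1"
    proof (rule symbs)
      show "length (enc_symb x) \<le> 4" if "x \<in> set (Nt 0 # map Tm u)" for x
        using that assms length_enc_symb_le(1)[of 0] length_enc_symb_le(2)[of 0]
          length_enc_symb_le(2)[of 1] by auto
    qed
    with length_enc_nat_le[of "Suc K"] show ?thesis by simp
  qed
  have pad: "length (enc_prod (padding_prod N j)) \<le> 8 * K + 20" if "j < K" for j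
  proof -
    have "length (enc_list enc_symb (snd (padding_prod N j))) \<le>
        length (snd (padding_prod N j)) * (2 * K + 2 + 1) + 1"
    proof (rule symbs)
      show "length (enc_symb x) \<le> 2 * K + 2" if "x \<in> set (snd (padding_prod N j))" for x
        using that \<open>j < K\<close> length_enc_symb_le(1)[of "Suc j"] length_enc_symb_le(2)[of 0]
        by (auto simp: padding_prod_def split: if_splits)
    qed
    also have "length (snd (padding_prod N j)) * (2 * K + 2 + 1) + 1 \<le> 3 * (2 * K + 2 + 1) + 1"
      by (intro add_mono mult_right_mono) (auto simp: padding_prod_def)
    finally show ?thesis
      using length_enc_nat_le[of j] that by (simp add: padding_prod_def)
  qed
  have "length (enc_prod (K, [])) \<le> 2 * K + 2"
    using length_enc_nat_le[of K] by (simp add: enc_list_simps)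
  with start pad
  have prods: "length (enc_prod x) \<le> 8 * K + 5 * length u + 29"
    if "x \<in> set (prods (padded K N u))" for x
    using that by (force simp: padded_def simp del: enc_prod.simps)
  have "length (enc_list enc_prod (prods (padded K N u))) \<le>
      length (prods (padded K N u)) * (8 * K + 5 * length u + 29 + 1) + 1"
    by (rule length_enc_list_le) (rule prods)
  then have "length (enc_list enc_prod (prods (padded K N u))) \<le>
      (K + 2) * (8 * K + 5 * length u + 30) + 1"
    by (simp add: padded_def algebra_simps)
  then show ?thesis
    using length_enc_nat_le[of "Suc K"] by (simp add: encode_def padded_def)
qed


section \<open>Polylogarithmic functions\<close>

lemma polylog_const: "polylog (\<lambda>_. c)"
  unfolding polylog_def by (rule exI[of _ 0]) simp

lemma polylog_mult:
  assumes "polylog f" "polylog g"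
  shows "polylog (\<lambda>n. f n * g n)"
proof -
  from assms obtain j k where "(\<lambda>n. real (f n)) \<in> O(\<lambda>n. log 2 (real n) ^ j)"
    "(\<lambda>n. real (g n)) \<in> O(\<lambda>n. log 2 (real n) ^ k)"
    unfolding polylog_def by blast
  from landau_o.big.mult[OF this] show ?thesis
    unfolding polylog_def by (intro exI[of _ "j + k"]) (simp add: power_add)
qed

lemma polylog_add:
  assumes "polylog f" "polylog g"
  shows "polylog (\<lambda>n. f n + g n)"
proof -
  \<comment> \<open>Eventually the logarithm is at least \<open>1\<close>, so both functions can be
    compared with the power of larger exponent.\<close>
  have mono: "(\<lambda>n. log 2 (real n) ^ j) \<in> O(\<lambda>n. log 2 (real n) ^ k)" if "j \<le> k" for j k
  proof (rule landau_o.big_mono)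
    have "\<forall>\<^sub>F n in sequentially. 1 \<le> log 2 (real n)" by real_asymp
    then show "\<forall>\<^sub>F n in sequentially. norm (log 2 (real n) ^ j) \<le> norm (log 2 (real n) ^ k)"
      by eventually_elim (use that in \<open>auto simp: power_increasing\<close>)
  qed
  from assms obtain j k where "(\<lambda>n. real (f n)) \<in> O(\<lambda>n. log 2 (real n) ^ j)"
    "(\<lambda>n. real (g n)) \<in> O(\<lambda>n. log 2 (real n) ^ k)"
    unfolding polylog_def by blast
  then have "(\<lambda>n. real (f n)) \<in> O(\<lambda>n. log 2 (real n) ^ max j k)"
    "(\<lambda>n. real (g n)) \<in> O(\<lambda>n. log 2 (real n) ^ max j k)"
    using landau_o.big_trans[OF _ mono[of j "max j k"]] landau_o.big_trans[OF _ mono[of k "max j k"]]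
    by simp_all
  from sum_in_bigo(1)[OF this] show ?thesis unfolding polylog_def by auto
qed

lemma polylog_log: "polylog (\<lambda>n. nat \<lfloor>log 2 (real n)\<rfloor>)"
  unfolding polylog_def
proof (intro exI[of _ 1] landau_o.big_mono)
  have "\<forall>\<^sub>F n in sequentially. 0 \<le> log 2 (real n)" by real_asymp
  then show "\<forall>\<^sub>F n in sequentially.
      norm (real (nat \<lfloor>log 2 (real n)\<rfloor>)) \<le> norm (log 2 (real n) ^ 1)"
    by eventually_elim simp
qed

lemma polylog_eventually_less:
  assumes "polylog f"
  shows "\<forall>\<^sub>F n in sequentially. f n < n"
proof -
  from assms obtain k where "(\<lambda>n. real (f n)) \<in> O(\<lambda>n. log 2 (real n) ^ k)"
    unfolding polylog_def by blast
  moreover have "(\<lambda>n. log 2 (real n) ^ k) \<in> o(\<lambda>n. real n)" by real_asymp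
  ultimately have "(\<lambda>n. real (f n)) \<in> o(\<lambda>n. real n)" by (rule landau_o.big_small_trans)
  \<comment> \<open>The factor \<open>1/2\<close> makes the final inequality strict for positive
    \<open>n\<close>.\<close>
  from landau_o.smallD[OF this, of "1/2"]
  have "\<forall>\<^sub>F n in sequentially. norm (real (f n)) \<le> 1 / 2 * norm (real n)" by simp
  then show ?thesis
    using eventually_gt_at_top[of 0] by eventually_elim auto
qed


theorem theorem5:
  fixes \<sigma> :: nat
  assumes "\<sigma> \<ge> 2"
  shows "\<not> (\<exists>q A m p.
    \<sigma> \<le> q \<and> one_stream_algorithm q A \<and> polylog m \<and> polylog p \<and>
    (\<forall>g. polylog g \<longrightarrow>
      (\<forall>\<^sub>F n in sequentially. \<forall>G s.
         over_alphabet \<sigma> G \<and> language G = {s} \<and> length s = n \<and> length (encode G) \<le> g n \<longrightarrow>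
         writes_out A (m n) (p n) (encode G) s)))"
proof (intro notI, elim exE conjE)
  fix q A m p
  assume q: "\<sigma> \<le> q" and A: "one_stream_algorithm q A" and polylog: "polylog m" "polylog p"
    and writes: "\<forall>g. polylog g \<longrightarrow>
      (\<forall>\<^sub>F n in sequentially. \<forall>G s.
         over_alphabet \<sigma> G \<and> language G = {s} \<and> length s = n \<and> length (encode G) \<le> g n \<longrightarrow>
         writes_out A (m n) (p n) (encode G) s)"
  \<comment> \<open>One more than the bound in \<open>writes_out_all_suffixes\<close>.\<close>
  define l where "l n = (m n + 1) * (p n + 1) + 1" for n
  \<comment> \<open>The binary length of \<open>n\<close>, which ensures
    \<open>n < 2 ^ K n\<close>.\<close>
  define K where "K n = nat \<lfloor>log 2 (real n)\<rfloor> + 1" for n :: nat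
  \<comment> \<open>The bound of \<open>length_encode_padded\<close> at
    \<open>length u = l n\<close>. It does not depend on \<open>u\<close>, so the assumption can be
    instantiated before \<open>n\<close> and \<open>u\<close> are chosen.\<close>
  define g where "g n = (K n + 2) * (8 * K n + 5 * l n + 30) + 2 * K n + 4" for n
  note polylog_intros = polylog_add polylog_mult polylog_const polylog_log polylog
  have "polylog l" unfolding l_def by (intro polylog_intros)
  moreover have "polylog g" unfolding g_def K_def l_def by (intro polylog_intros)
  \<comment> \<open>This leaves more than \<open>g n\<close> padding zeros, so the prefix is at
    least as long as the encoded input.\<close>
  ultimately have "\<forall>\<^sub>F n in sequentially. g n + l n < n"
    by (intro polylog_eventually_less polylog_add)
  with writes[rule_format, OF \<open>polylog g\<close>]
  have "\<forall>\<^sub>F n in sequentially. g n + l n < n \<and> (\<forall>G s.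
         over_alphabet \<sigma> G \<and> language G = {s} \<and> length s = n \<and> length (encode G) \<le> g n \<longrightarrow>
         writes_out A (m n) (p n) (encode G) s)"
    by eventually_elim blast
  from eventually_happens'[OF sequentially_bot this]
  obtain n where n: "g n + l n < n" and writes: "\<forall>G s.
         over_alphabet \<sigma> G \<and> language G = {s} \<and> length s = n \<and> length (encode G) \<le> g n \<longrightarrow>
         writes_out A (m n) (p n) (encode G) s"
    by blast
  define N where "N = n - l n"
  have "log 2 (real n) < real (K n)"
    unfolding K_def by linarith
  then have "real n < 2 powr real (K n)"
    using n by (subst (asm) log_less_iff) simp_all
  then have "n < 2 ^ K n" by (simp add: powr_realpow flip: of_nat_less_iff)
  then have N: "N < 2 ^ K n" "g n < N" using n by (auto simp: N_def)
  have "l n \<le> (m n + 1) * (p n + 1)"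
  proof (rule writes_out_all_suffixes[OF A])
    fix u :: "nat list"
    assume u: "set u \<subseteq> {0, 1}" "length u = l n"
    let ?G = "padded (K n) N u"
    have size: "length (encode ?G) \<le> g n"
      using length_encode_padded[OF u(1), of "K n" N] u(2) by (simp add: g_def)
    have "over_alphabet \<sigma> ?G"
      using assms u(1) by (auto simp: over_alphabet_def padded_def padding_prod_def split: if_splits)
    then have "writes_out A (m n) (p n) (encode ?G) (replicate N 0 @ u)"
      using n u(2) size language_padded[OF N(1), of u]
      by (intro writes[rule_format]) (simp add: N_def)
    moreover have "length (encode ?G) \<le> length (replicate N 0)" "replicate N 0 \<noteq> []"
      using size N(2) by auto
    ultimately show "\<exists>x v. length x \<le> length v \<and> v \<noteq> [] \<and> writes_out A (m n) (p n) x (v @ u)"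
      by blast
  qed (use assms q in \<open>auto simp: l_def\<close>)
  then show False by (simp add: l_def)
qed

end
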